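(* Let $p,N\in\mathbb{N}$ with $p\le N$ and let $f:\mathbb{R}^{N\times p}\to\mathbb{R}$ be differentiable. Let $U\in\mathrm{St}(p,N)$ and $S\in\mathrm{O}(N)$ satisfy $U\in\mathrm{St}(p,N)\setminus E_{N,p}(S)$. Then the first-order optimality condition $$\begin{cases}(I-UU^T)\nabla f(U)=0\\ U^T\nabla f(U)-\nabla f(U)^TU=0\end{cases}$$ can be stated equivalently as $$\nabla f_S(\Phi_S(U))=0,$$ where $f_S:=f\circ\Phi_S^{-1}$.
   Context: Notation: $\mathrm{St}(p,N)=\{U\in\mathbb{R}^{N\times p}\mid U^TU=I_p\}$, $\mathrm{O}(N)=\mathrm{St}(N,N)$. $I$ is the $N\times N$ identity, $I_{N\times p}$ the matrix of its first $p$ columns. For $S\in\mathbb{R}^{N\times N}$, $S=[S_{\rm le}\ S_{\rm ri}]$ with $S_{\rm le}\in\mathbb{R}^{N\times p}$, $S_{\rm ri}\in\mathbb{R}^{N\times(N-p)}$ (blocks of size zero are omitted when $p=N$). $\mathrm{Skew}(X)=(X-X^T)/2$. $E_{N,p}(S):=\{U\in\mathrm{St}(p,N)\mid\det(I_p+S_{\rm le}^TU)=0\}$, $$Q_{N,p}(S):=\left\{\begin{bmatrix}A&-B^T\\ B&0\end{bmatrix}\ \middle|\ A\in\mathbb{R}^{p\times p},\ A^T=-A,\ B\in\mathbb{R}^{(N-p)\times p}\right\}.$$ The generalized left-localized Cayley transform centered at $S\in\mathrm{O}(N)$ is $$\Phi_S:\mathrm{St}(p,N)\setminus E_{N,p}(S)\to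 Q_{N,p}(S):U\mapsto\begin{bmatrix}A_S(U)&-B_S(U)^T\\ B_S(U)&0\end{bmatrix},$$ $$A_S(U)=2(I_p+S_{\rm le}^TU)^{-T}\,\mathrm{Skew}(U^TS_{\rm le})\,(I_p+S_{\rm le}^TU)^{-1},\qquad B_S(U)=-S_{\rm ri}^TU(I_p+S_{\rm le}^TU)^{-1},$$ with inverse $\Phi_S^{-1}(V)=S(I-V)(I+V)^{-1}I_{N\times p}$ for $V\in Q_{N,p}(S)$. Gradients are taken with respect to the inner product $\langle X,Y\rangle=\mathrm{Tr}(X^TY)$; $\nabla f_S(V)$ is the element of the vector space $Q_{N,p}(S)$ with $\frac{d}{dt}f_S(V+tD)|_{t=0}=\mathrm{Tr}(\nabla f_S(V)^TD)$ for all $D\in Q_{N,p}(S)$. *)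

theory Defs
  imports "HOL-Analysis.Analysis"
begin

type_synonym ('n,'p) rmat = "real^'p^'n"

(* A matrix with N rows and p columns is an element of ('n,'p) rmat with N = CARD('n) and
   p = CARD('p).  The index types carry linear orders, so that "the first p columns" makes
   sense: if p <= N, then left_idx embeds 'p onto the p smallest elements of 'n, in order. *)
definition left_idx :: "'p::{finite,linorder} \<Rightarrow> 'n::{finite,linorder}" where
  "left_idx k = (THE i. card {j. j < i} = card {l. l < k})"

lemma strict_mono_card_less: "strict_mono (\<lambda>i::'a::{finite,linorder}. card {j. j < i})"
  by (rule strict_monoI) (auto intro!: psubset_card_mono)

lemma bij_betw_card_less:
  "bij_betw (\<lambda>i::'a::{finite,linorder}. card {j. j < i}) UNIV {..<CARD('a)}"
proof -
  let ?r = "\<lambda>i::'a. card {j. j < i}"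
  have inj: "inj ?r"
    using strict_mono_card_less by (rule strict_mono_imp_inj_on)
  have "?r i < CARD('a)" for i
    by (rule psubset_card_mono) auto
  then have "range ?r \<subseteq> {..<CARD('a)}"
    by auto
  moreover have "card (range ?r) = CARD('a)"
    using inj by (rule card_image)
  ultimately have "range ?r = {..<CARD('a)}"
    by (intro card_subset_eq) auto
  with inj show ?thesis
    by (simp add: bij_betw_def)
qed

lemma card_less_left_idx:
  fixes k :: "'p::{finite,linorder}"
  assumes "CARD('p) \<le> CARD('n::{finite,linorder})"
  shows "card {j. j < (left_idx k :: 'n)} = card {l. l < k}"
proof -
  have "card {l. l < k} < CARD('p)"
    by (rule psubset_card_mono) auto
  then have "card {l. l < k} \<in> range (\<lambda>i::'n. card {j. j < i})"
    using assms bij_betw_card_less[where 'a = 'n] by (simp add: bij_betw_def)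
  then obtain i :: 'n where i: "card {j. j < i} = card {l. l < k}"
    by force
  moreover have "i' = i" if "card {j. j < i'} = card {l. l < k}" for i' :: 'n
    using that i bij_betw_card_less[where 'a = 'n] by (auto simp: bij_betw_def inj_def)
  ultimately show ?thesis
    unfolding left_idx_def by (rule theI)
qed

lemma strict_mono_left_idx:
  assumes "CARD('p::{finite,linorder}) \<le> CARD('n::{finite,linorder})"
  shows "strict_mono (left_idx :: 'p \<Rightarrow> 'n)"
proof (rule strict_monoI)
  fix k l :: 'p
  assume "k < l"
  then have "card {j. j < (left_idx k :: 'n)} < card {j. j < (left_idx l :: 'n)}"
    using strict_mono_card_less[where 'a = 'p]
    by (simp add: card_less_left_idx[OF assms] strict_mono_def)
  then show "(left_idx k :: 'n) < left_idx l"
    using strict_mono_less[OF strict_mono_card_less[where 'a = 'n]] by blast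
qed

definition stiefel :: "(('n::finite,'p::finite) rmat) set" where
  "stiefel = {U. transpose U ** U = mat 1}"

definition skew :: "('n::finite,'n) rmat \<Rightarrow> ('n,'n) rmat" where
  "skew X = (1/2) *\<^sub>R (X - transpose X)"

definition I_left :: "('n::{finite,linorder},'p::{finite,linorder}) rmat" where
  "I_left = (\<chi> i k. if i = left_idx k then 1 else 0)"

definition S_le :: "('n::{finite,linorder},'n) rmat \<Rightarrow> ('n,'p::{finite,linorder}) rmat" where
  "S_le S = (\<chi> i k. S $ i $ left_idx k)"

(* The index set of size N - p is empty for p = N, hence not a type.  The last N - p columns
   of S keep their indices in 'n; the columns with the first p indices are filled with 0.
   The result depends on 'p, so the type is passed explicitly. *)
definition S_ri :: "'p::{finite,linorder} itself \<Rightarrow> ('n::{finite,linorder},'n) rmat \<Rightarrow> ('n,'n) rmat" where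
  "S_ri _ S = (\<chi> i j. if j \<in> range (left_idx :: 'p \<Rightarrow> 'n) then 0 else S $ i $ j)"

(* The block matrix [A, -B^T; B, 0].  The N - p rows of the block B are the rows of the
   argument B with index outside the first p; its other rows are not used. *)
definition block_mat ::
  "('p::{finite,linorder},'p) rmat \<Rightarrow> ('n::{finite,linorder},'p) rmat \<Rightarrow> ('n,'n) rmat" where
  "block_mat A B = (\<chi> i j.
     let L = range (left_idx :: 'p \<Rightarrow> 'n); pos = inv (left_idx :: 'p \<Rightarrow> 'n) in
     if i \<in> L \<and> j \<in> L then A $ pos i $ pos j
     else if i \<in> L then - (B $ j $ pos i)
     else if j \<in> L then B $ i $ pos j
     else 0)"

(* Q_{N,p}(S) is the same space for every center S. *)
definition Q_space :: "'p::{finite,linorder} itself \<Rightarrow> (('n::{finite,linorder},'n) rmat) set" where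
  "Q_space _ =
     {block_mat A B | (A :: ('p,'p) rmat) (B :: ('n,'p) rmat). transpose A = - A}"

definition E_set :: "('n::{finite,linorder},'n) rmat \<Rightarrow> (('n,'p::{finite,linorder}) rmat) set" where
  "E_set S = {U \<in> stiefel. det (mat 1 + transpose (S_le S) ** U) = 0}"

definition cayley_A ::
  "('n::{finite,linorder},'n) rmat \<Rightarrow> ('n,'p::{finite,linorder}) rmat \<Rightarrow> ('p,'p) rmat" where
  "cayley_A S U =
     (let M = matrix_inv (mat 1 + transpose (S_le S) ** U)
      in 2 *\<^sub>R (transpose M ** skew (transpose U ** S_le S) ** M))"

definition cayley_B ::
  "('n::{finite,linorder},'n) rmat \<Rightarrow> ('n,'p::{finite,linorder}) rmat \<Rightarrow> ('n,'p) rmat" where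
  "cayley_B S U =
     - (transpose (S_ri TYPE('p) S) ** U ** matrix_inv (mat 1 + transpose (S_le S) ** U))"

definition cayley ::
  "('n::{finite,linorder},'n) rmat \<Rightarrow> ('n,'p::{finite,linorder}) rmat \<Rightarrow> ('n,'n) rmat" where
  "cayley S U = block_mat (cayley_A S U) (cayley_B S U)"

(* The closed form of the inverse of cayley S; mat 1 + V is invertible for V in Q_space, since
   V is skew-symmetric. *)
definition cayley_inv ::
  "('n::{finite,linorder},'n) rmat \<Rightarrow> ('n,'n) rmat \<Rightarrow> ('n,'p::{finite,linorder}) rmat" where
  "cayley_inv S V = S ** (mat 1 - V) ** matrix_inv (mat 1 + V) ** I_left"

definition frob_inner :: "('n::finite,'m::finite) rmat \<Rightarrow> ('n,'m) rmat \<Rightarrow> real" where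
  "frob_inner X Y = trace (transpose X ** Y)"

definition gradient :: "(('n::finite,'m::finite) rmat \<Rightarrow> real) \<Rightarrow> ('n,'m) rmat \<Rightarrow> ('n,'m) rmat" where
  "gradient f X = (THE G. (f has_derivative (\<lambda>D. frob_inner G D)) (at X))"

definition gradient_on ::
  "(('n::finite,'m::finite) rmat) set \<Rightarrow> (('n,'m) rmat \<Rightarrow> real) \<Rightarrow> ('n,'m) rmat \<Rightarrow> ('n,'m) rmat" where
  "gradient_on Q g V = (THE G. G \<in> Q \<and>
     (\<forall>D\<in>Q. ((\<lambda>t. g (V + t *\<^sub>R D)) has_real_derivative frob_inner G D) (at 0)))"

end

theory Submission
  imports Defs
begin

text \<open>
  The inverse Cayley transform parametrises a neighbourhood of \<open>U\<close> in the Stiefel manifold by the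
  vector space \<open>Q_space\<close>, and \<open>cayley S U\<close> is the parameter of \<open>U\<close> (\<open>cayley_inv_cayley\<close>). By the
  chain rule, the derivative of \<open>f \<circ> cayley_inv S\<close> at this parameter in the direction \<open>D\<close> is the
  inner product of \<open>gradient f U\<close> with \<open>\<Delta> D\<close>, where \<open>\<Delta>\<close> is the differential of \<open>cayley_inv S\<close>
  restricted to \<open>Q_space\<close>. So the gradient relative to \<open>Q_space\<close> vanishes iff \<open>gradient f U\<close> is
  orthogonal to the range of \<open>\<Delta>\<close>. This range is the whole tangent space of the Stiefel manifold
  at \<open>U\<close> (\<open>cayley_inv_derivative_range\<close>), and orthogonality to the tangent space is the first-order
  optimality condition (\<open>stationary_iff_orthogonal_tangent\<close>).

  Throughout, let \<open>V = cayley S U\<close>, let \<open>K\<close> be the inverse of \<open>mat 1 + V\<close>, and let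
  \<open>X = transpose S ** U\<close>. All computations with the transform go through the relation
  \<open>2 *\<^sub>R (K ** I_left) = X + I_left\<close> (\<open>resolvent_cayley_I_left\<close>). It gives the inversion formula, and
  it turns \<open>\<Delta> D = (-2) *\<^sub>R (S ** K ** D ** K ** I_left)\<close> into \<open>- (S ** K ** D ** (X + I_left))\<close>.
  Surjectivity of \<open>\<Delta>\<close> thereby becomes the linear equation \<open>D ** (X + I_left) = W\<close> for \<open>D\<close> in
  \<open>Q_space\<close>. It has a triangular block structure with the diagonal block
  \<open>mat 1 + transpose I_left ** X\<close>, whose invertibility is the assumption that \<open>U\<close> lies outside
  \<open>E_set S\<close> (\<open>Q_space_mult_shift_surj\<close>).
\<close>

section \<open>Matrix algebra and the Frobenius inner product\<close>

lemma matrix_add_rdistrib: "(A + B) ** (C :: real^'p^'m) = A ** C + B ** C" for A :: "real^'m^'n"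
  by (simp add: matrix_matrix_mult_def vec_eq_iff sum.distrib algebra_simps)

lemma matrix_diff_ldistrib: "A ** (B - C :: real^'p^'m) = A ** B - A ** C" for A :: "real^'m^'n"
  by (simp add: matrix_matrix_mult_def vec_eq_iff sum_subtractf algebra_simps)

lemma matrix_diff_rdistrib: "(A - B) ** (C :: real^'p^'m) = A ** C - B ** C" for A :: "real^'m^'n"
  by (simp add: matrix_matrix_mult_def vec_eq_iff sum_subtractf algebra_simps)

lemma matrix_minus_left: "(- A) ** (C :: real^'p^'m) = - (A ** C)" for A :: "real^'m^'n"
  by (simp add: matrix_matrix_mult_def vec_eq_iff sum_negf)

lemma matrix_minus_right: "A ** (- C :: real^'p^'m) = - (A ** C)" for A :: "real^'m^'n"
  by (simp add: matrix_matrix_mult_def vec_eq_iff sum_negf)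

lemma matrix_scaleR_left: "(c *\<^sub>R A) ** (C :: real^'p^'m) = c *\<^sub>R (A ** C)" for A :: "real^'m^'n"
  by (simp add: scalar_matrix_assoc)

lemma matrix_scaleR_right: "A ** (c *\<^sub>R C :: real^'p^'m) = c *\<^sub>R (A ** C)" for A :: "real^'m^'n"
  by (simp add: matrix_scalar_ac scalar_matrix_assoc)

lemma transpose_add: "transpose (A + B) = transpose A + transpose B" for A B :: "real^'m^'n"
  by (simp add: transpose_def vec_eq_iff)

lemma transpose_diff: "transpose (A - B) = transpose A - transpose B" for A B :: "real^'m^'n"
  by (simp add: transpose_def vec_eq_iff)

lemma transpose_minus: "transpose (- A) = - transpose A" for A :: "real^'m^'n"
  by (simp add: transpose_def vec_eq_iff)

text \<open>Matrices of varying shapes do not form a ring type, so the ring normalisation of the simplifier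
  does not apply to them. These rules expand a matrix expression into a linear combination of
  right-associated products in which transposition is applied to single factors only.\<close>

lemmas mat_expand = matrix_mul_assoc[symmetric] matrix_add_ldistrib matrix_add_rdistrib
  matrix_diff_ldistrib matrix_diff_rdistrib matrix_minus_left matrix_minus_right
  matrix_scaleR_left matrix_scaleR_right matrix_transpose_mul
  transpose_add transpose_diff transpose_minus transpose_scalar

text \<open>Makes a pair of mutually inverse factors cancel inside a right-associated product.\<close>

lemma matrix_mul_cancel: "A ** B = mat 1 \<Longrightarrow> A ** (B ** X) = X"
  for A :: "real^'m^'n" and B :: "real^'n^'m" and X :: "real^'p^'n"
  by (simp add: matrix_mul_assoc)

lemma matrix_inv_mult:
  fixes A :: "real^'n^'n"
  assumes "invertible A"
  shows "A ** matrix_inv A = mat 1" and "matrix_inv A ** A = mat 1"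
  using assms unfolding invertible_def matrix_inv_def by (metis (mono_tags, lifting) someI_ex)+

lemma frob_inner_eq_inner: "frob_inner X Y = inner X Y"
  unfolding frob_inner_def trace_def matrix_matrix_mult_def transpose_def inner_vec_def
  by (simp add: sum.swap[of "\<lambda>i k. X $ k $ i * Y $ k $ i"])

text \<open>Lets a matrix factor change sides, which takes the place of manipulations of traces.\<close>

lemma inner_matrix_mult_left: "inner (A ** X) Y = inner X (transpose A ** Y)"
  for A :: "real^'m^'n" and X :: "real^'p^'m"
  unfolding frob_inner_eq_inner[symmetric] frob_inner_def by (simp add: mat_expand)

lemma inner_transpose: "inner (transpose X) (transpose Y) = inner X Y" for X Y :: "real^'m^'n"
  unfolding inner_vec_def transpose_def
  by (simp add: sum.swap[of "\<lambda>i k. X $ k $ i * Y $ k $ i"])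

lemma inner_symmetric_skew:
  fixes A B :: "real^'n^'n"
  assumes "transpose A = A" "transpose B = - B"
  shows "inner A B = 0"
  using inner_transpose[of A B] assms by simp

section \<open>Resolvents of skew-symmetric matrices\<close>

lemma inner_skew_mult_eq_0:
  fixes V :: "real^'n^'n" and Y :: "real^'p^'n"
  assumes "transpose V = - V"
  shows "inner Y (V ** Y) = 0"
proof -
  have "inner Y (V ** Y) = - inner (V ** Y) Y"
    by (simp add: inner_matrix_mult_left assms mat_expand)
  then show ?thesis by (simp add: inner_commute)
qed

text \<open>The cross term of the expanded square vanishes because \<open>Y\<close> is orthogonal to \<open>V ** Y\<close>. This
  makes \<open>mat 1 + V\<close> invertible, and it bounds the resolvent by 1 uniformly in the skew matrix,
  which is what the differentiation of the resolvent needs.\<close>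

lemma norm_le_norm_one_plus_skew_mult:
  fixes V :: "real^'n^'n" and Y :: "real^'p^'n"
  assumes "transpose V = - V"
  shows "norm Y \<le> norm ((mat 1 + V) ** Y)"
  unfolding norm_le
  using inner_skew_mult_eq_0[OF assms, of Y]
  by (simp add: mat_expand inner_add_left inner_add_right inner_commute)

lemma resolvent_skew:
  fixes V :: "real^'n^'n"
  assumes "transpose V = - V"
  shows "(mat 1 + V) ** matrix_inv (mat 1 + V) = mat 1"
    and "matrix_inv (mat 1 + V) ** (mat 1 + V) = mat 1"
proof -
  have "x = 0" if "(mat 1 + V) *v x = 0" for x
  proof -
    define Y :: "real^1^'n" where "Y = (\<chi> i j. x $ i)"
    have "(mat 1 + V) ** Y = 0"
      using that by (simp add: Y_def matrix_matrix_mult_def matrix_vector_mult_def vec_eq_iff)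
    then have "Y = 0"
      using norm_le_norm_one_plus_skew_mult[OF assms, of Y] by simp
    then show "x = 0" by (simp add: Y_def vec_eq_iff)
  qed
  then have "invertible (mat 1 + V)"
    by (simp add: invertible_left_inverse matrix_left_invertible_ker)
  then show "(mat 1 + V) ** matrix_inv (mat 1 + V) = mat 1"
    and "matrix_inv (mat 1 + V) ** (mat 1 + V) = mat 1"
    by (rule matrix_inv_mult)+
qed

lemma norm_resolvent_skew_mult_le:
  fixes V :: "real^'n^'n" and Y :: "real^'p^'n"
  assumes "transpose V = - V"
  shows "norm (matrix_inv (mat 1 + V) ** Y) \<le> norm Y"
  using norm_le_norm_one_plus_skew_mult[OF assms, of "matrix_inv (mat 1 + V) ** Y"]
  by (simp add: matrix_mul_cancel resolvent_skew[OF assms])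

text \<open>The resolvent identity: multiply \<open>(mat 1 + W) - (mat 1 + V) = W - V\<close> by the two inverses.\<close>

lemma resolvent_skew_diff:
  fixes V D :: "real^'n^'n"
  assumes "transpose V = - V" "transpose W = - W"
  shows "matrix_inv (mat 1 + W) - matrix_inv (mat 1 + V)
    = - (matrix_inv (mat 1 + W) ** (W - V) ** matrix_inv (mat 1 + V))"
proof -
  let ?K = "matrix_inv (mat 1 + V)" and ?L = "matrix_inv (mat 1 + W)"
  have "?L ** ((mat 1 + W) ** ?K) - ?L ** ((mat 1 + V) ** ?K) = ?L ** ((W - V) ** ?K)"
    by (simp add: mat_expand)
  then have "?K - ?L = ?L ** ((W - V) ** ?K)"
    by (simp only: matrix_mul_cancel[OF resolvent_skew(2)[OF assms(2)]]
        resolvent_skew(1)[OF assms(1)] matrix_mul_rid)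
  then show ?thesis by (metis minus_diff_eq matrix_mul_assoc)
qed

lemma stiefel_square: "S \<in> stiefel \<Longrightarrow> S ** transpose S = mat 1" for S :: "real^'n^'n"
  by (simp add: stiefel_def matrix_left_right_inverse)

text \<open>Since \<open>mat 1 - V = 2 *\<^sub>R mat 1 - (mat 1 + V)\<close>, the inverse Cayley transform depends on \<open>V\<close>
  only through the resolvent, in an affine way.\<close>

lemma cayley_inv_skew:
  fixes S V :: "('n::{finite,linorder},'n) rmat"
  assumes "transpose V = - V"
  shows "(cayley_inv S V :: ('n,'p::{finite,linorder}) rmat)
    = S ** (2 *\<^sub>R (matrix_inv (mat 1 + V) ** I_left) - I_left)"
proof -
  let ?K = "matrix_inv (mat 1 + V)"
  have "(mat 1 - V) ** ?K = (2 *\<^sub>R mat 1 - (mat 1 + V)) ** ?K"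
    by (simp add: scaleR_2)
  also have "\<dots> = 2 *\<^sub>R ?K - mat 1"
    by (simp only: matrix_diff_rdistrib resolvent_skew[OF assms] matrix_scaleR_left matrix_mul_lid)
  finally have "(mat 1 - V) ** ?K = 2 *\<^sub>R ?K - mat 1" .
  moreover have "(cayley_inv S V :: ('n,'p) rmat) = S ** (((mat 1 - V) ** ?K) ** I_left)"
    by (simp only: cayley_inv_def matrix_mul_assoc)
  ultimately show ?thesis
    by (simp only: matrix_diff_rdistrib matrix_scaleR_left matrix_mul_lid)
qed

text \<open>By the affine formula it suffices to differentiate the resolvent. Applying the resolvent identity
  twice writes it as its first-order expansion plus \<open>t\<^sup>2\<close> times a product in which the
  only factor depending on \<open>t\<close> is a resolvent of a skew matrix, hence of norm at most 1. So the
  remainder is \<open>O(t\<^sup>2)\<close>.\<close>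

lemma cayley_inv_has_vector_derivative:
  fixes S V D :: "('n::{finite,linorder},'n) rmat"
  assumes V: "transpose V = - V" and D: "transpose D = - D"
  defines "K \<equiv> matrix_inv (mat 1 + V)"
  shows "((\<lambda>t. cayley_inv S (V + t *\<^sub>R D) :: ('n,'p::{finite,linorder}) rmat)
    has_vector_derivative (-2) *\<^sub>R (S ** K ** D ** K ** I_left)) (at 0)"
proof -
  let ?J = "I_left :: ('n,'p) rmat"
  let ?c = "\<lambda>t. cayley_inv S (V + t *\<^sub>R D) :: ('n,'p) rmat"
  let ?d = "(-2) *\<^sub>R (S ** K ** D ** K ** ?J)"
  let ?Y = "D ** (K ** (D ** (K ** ?J)))"
  let ?C = "2 * onorm ((**) S :: _ \<Rightarrow> ('n,'p) rmat) * norm ?Y"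
  have bl: "bounded_linear ((**) S :: _ \<Rightarrow> ('n,'p) rmat)"
    by (intro linear_conv_bounded_linear[THEN iffD1] linearI) (simp_all add: mat_expand)
  have vec: "(2 *\<^sub>R (x - t *\<^sub>R (y - t *\<^sub>R z)) - j) - (2 *\<^sub>R x - j)
      - t *\<^sub>R (-2) *\<^sub>R y = (2 * t\<^sup>2) *\<^sub>R z"
    for t :: real and x y z j :: "('n,'p) rmat"
    by (simp add: algebra_simps power2_eq_square)
  have bound: "norm (?c t - ?c 0 - t *\<^sub>R ?d) \<le> ?C * t\<^sup>2" for t
  proof -
    define L where "L = matrix_inv (mat 1 + (V + t *\<^sub>R D))"
    have W: "transpose (V + t *\<^sub>R D) = - (V + t *\<^sub>R D)"
      by (simp add: mat_expand V D)
    have LK: "L ** X = K ** X - t *\<^sub>R (L ** (D ** (K ** X)))" for X :: "('n,'p) rmat"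
    proof -
      have "L - K = - t *\<^sub>R (L ** D ** K)"
        using resolvent_skew_diff[OF V W] by (simp add: L_def K_def mat_expand)
      then have "L ** X = (K + - t *\<^sub>R (L ** D ** K)) ** X"
        by (metis add_diff_cancel_left' diff_add_cancel add.commute)
      then show ?thesis by (simp add: mat_expand)
    qed
    have L: "L ** ?J = K ** ?J - t *\<^sub>R (K ** (D ** (K ** ?J)) - t *\<^sub>R (L ** ?Y))"
      using LK[of ?J] unfolding LK[of "D ** (K ** ?J)"] .
    have "?c t - ?c 0 - t *\<^sub>R ?d
        = S ** ((2 *\<^sub>R (L ** ?J) - ?J) - (2 *\<^sub>R (K ** ?J) - ?J)
            - t *\<^sub>R (-2) *\<^sub>R (K ** (D ** (K ** ?J))))"
      by (simp only: scale_zero_left add_0_right cayley_inv_skew[OF V] cayley_inv_skew[OF W]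
          L_def K_def matrix_diff_ldistrib matrix_scaleR_right matrix_mul_assoc)
    also have "(2 *\<^sub>R (L ** ?J) - ?J) - (2 *\<^sub>R (K ** ?J) - ?J)
            - t *\<^sub>R (-2) *\<^sub>R (K ** (D ** (K ** ?J))) = (2 * t\<^sup>2) *\<^sub>R (L ** ?Y)"
      unfolding L by (rule vec)
    finally have "norm (?c t - ?c 0 - t *\<^sub>R ?d) = 2 * t\<^sup>2 * norm (S ** (L ** ?Y))"
      by (simp only: matrix_scaleR_right norm_scaleR) simp
    moreover have SL: "norm (S ** (L ** ?Y)) \<le> onorm ((**) S :: _ \<Rightarrow> ('n,'p) rmat) * norm ?Y"
      using onorm[OF bl, of "L ** ?Y"]
        mult_left_mono[OF norm_resolvent_skew_mult_le[OF W, of ?Y] onorm_pos_le[OF bl]]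
      unfolding L_def by (rule order_trans)
    ultimately show ?thesis
      using mult_left_mono[OF SL, of "2 * t\<^sup>2"] by (simp only: mult_ac) simp
  qed
  have "((\<lambda>t::real. ?C * \<bar>t\<bar>) \<longlongrightarrow> 0) (at 0)"
    by (auto intro!: tendsto_eq_intros)
  moreover have "norm (?c t - ?c 0 - (t - 0) *\<^sub>R ?d) / norm (t - 0) \<le> ?C * \<bar>t\<bar>"
    if "t \<noteq> 0" for t
    using bound[of t] that
    by (simp add: divide_le_eq mult.assoc power2_eq_square[symmetric] del: scaleR_minus_left)
  ultimately show ?thesis
    unfolding has_vector_derivative_def
    by (intro has_derivativeI_sandwich[where e = 1 and H = "\<lambda>t. ?C * \<bar>t\<bar>"]
        bounded_linear_scaleR_left) simp_all
qed

section \<open>The Cayley transform in block form\<close>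

text \<open>The orthogonal projection onto the coordinates outside the first \<open>p\<close>. It replaces the lower
  blocks of the block notation, whose row index set has size \<open>N - p\<close> and may be empty.\<close>

definition right_proj :: "'p::{finite,linorder} itself \<Rightarrow> ('n::{finite,linorder},'n) rmat" where
  "right_proj _ = mat 1 - I_left ** transpose (I_left :: ('n,'p) rmat)"

lemma I_left_nth: "I_left $ i $ k = (if i = left_idx k then 1 else 0)"
  by (simp add: I_left_def)

lemma I_left_mult_nth:
  fixes A :: "real^'m^'p::{finite,linorder}" and i :: "'n::{finite,linorder}"
  assumes "CARD('p) \<le> CARD('n)"
  shows "(I_left ** A) $ i $ j
    = (if i \<in> range (left_idx :: 'p \<Rightarrow> 'n) then A $ inv left_idx i $ j else 0)"
proof (cases "i \<in> range (left_idx :: 'p \<Rightarrow> 'n)")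
  case True
  have inj: "inj (left_idx :: 'p \<Rightarrow> 'n)"
    using strict_mono_left_idx[OF assms] by (rule strict_mono_imp_inj_on)
  from True obtain k :: 'p where k: "i = left_idx k" by blast
  have "(I_left ** A) $ i $ j = (\<Sum>l\<in>UNIV. if l = k then A $ l $ j else 0)"
    unfolding matrix_matrix_mult_def I_left_def k
    by (simp only: vec_lambda_beta inj_eq[OF inj], rule sum.cong) auto
  then show ?thesis using True inj k by simp
next
  case False
  then show ?thesis
    unfolding matrix_matrix_mult_def I_left_def by (auto intro!: sum.neutral)
qed

lemma transpose_I_left_mult_nth:
  fixes A :: "real^'m^'n::{finite,linorder}" and k :: "'p::{finite,linorder}"
  shows "(transpose I_left ** A) $ k $ j = A $ left_idx k $ j"
proof -
  have "(transpose I_left ** A) $ k $ j = (\<Sum>i\<in>UNIV. if i = left_idx k then A $ i $ j else 0)"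
    unfolding matrix_matrix_mult_def I_left_def transpose_def
    by (simp only: vec_lambda_beta, rule sum.cong) auto
  then show ?thesis by simp
qed

lemma I_left_orthonormal:
  assumes "CARD('p::{finite,linorder}) \<le> CARD('n::{finite,linorder})"
  shows "transpose I_left ** (I_left :: ('n,'p) rmat) = mat 1"
proof -
  have inj: "inj (left_idx :: 'p \<Rightarrow> 'n)"
    using strict_mono_left_idx[OF assms] by (rule strict_mono_imp_inj_on)
  show ?thesis
    by (auto simp: vec_eq_iff transpose_I_left_mult_nth mat_def I_left_nth inj_eq[OF inj])
qed

lemma right_proj_simps:
  assumes "CARD('p::{finite,linorder}) \<le> CARD('n::{finite,linorder})"
  shows "transpose (right_proj TYPE('p)) = (right_proj TYPE('p) :: ('n,'n) rmat)"
    and "right_proj TYPE('p) ** (I_left :: ('n,'p) rmat) = 0"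
    and "transpose (I_left :: ('n,'p) rmat) ** right_proj TYPE('p) = 0"
    and "right_proj TYPE('p) ** right_proj TYPE('p) = (right_proj TYPE('p) :: ('n,'n) rmat)"
  unfolding right_proj_def
  by (simp_all add: mat_expand I_left_orthonormal[OF assms] matrix_mul_cancel)

lemma right_proj_mult_nth:
  fixes A :: "real^'m^'n::{finite,linorder}"
  assumes "CARD('p::{finite,linorder}) \<le> CARD('n)"
  shows "(right_proj TYPE('p) ** A) $ i $ j
    = (if i \<in> range (left_idx :: 'p \<Rightarrow> 'n) then 0 else A $ i $ j)"
  unfolding right_proj_def mat_expand
  by (auto simp: I_left_mult_nth[OF assms] transpose_I_left_mult_nth f_inv_into_f mat_expand)

lemma S_le_eq: "S_le S = S ** I_left"
  unfolding S_le_def I_left_def matrix_matrix_mult_def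
  by (simp add: vec_eq_iff if_distrib cong: if_cong)

lemma S_ri_eq:
  fixes S :: "('n::{finite,linorder},'n) rmat"
  assumes "CARD('p::{finite,linorder}) \<le> CARD('n)"
  shows "S_ri TYPE('p) S = S ** right_proj TYPE('p)"
proof -
  have "transpose (S_ri TYPE('p) S) = right_proj TYPE('p) ** transpose S"
    by (auto simp: vec_eq_iff right_proj_mult_nth[OF assms] S_ri_def transpose_def)
  then have "transpose (transpose (S_ri TYPE('p) S)) = S ** right_proj TYPE('p)"
    by (simp only: mat_expand right_proj_simps[OF assms] transpose_transpose)
  then show ?thesis by simp
qed

text \<open>The block matrix without case distinctions on the indices; from here on only this form and the
  relations between \<open>I_left\<close> and \<open>right_proj\<close> are used.\<close>

lemma block_mat_eq:
  fixes A :: "('p::{finite,linorder},'p) rmat" and B :: "('n::{finite,linorder},'p) rmat"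
  assumes "CARD('p) \<le> CARD('n)"
  shows "block_mat A B = I_left ** A ** transpose I_left
    + right_proj TYPE('p) ** B ** transpose I_left
    - I_left ** transpose B ** right_proj TYPE('p)"
proof -
  \<comment> \<open>The entries of right factors follow from those of left factors by transposition.\<close>
  have 1: "(X ** transpose (I_left :: ('n,'p) rmat)) $ i $ j
      = (if j \<in> range (left_idx :: 'p \<Rightarrow> 'n) then X $ i $ inv left_idx j else 0)"
    for X :: "('n,'p) rmat" and i j
    using I_left_mult_nth[OF assms, of "transpose X" j i]
    by (metis (no_types, lifting) matrix_transpose_mul transpose_transpose transpose_def vec_lambda_beta)
  have 2: "(X ** right_proj TYPE('p)) $ i $ j
      = (if j \<in> range (left_idx :: 'p \<Rightarrow> 'n) then 0 else X $ i $ j)"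
    for X :: "('n,'n) rmat" and i j
    using right_proj_mult_nth[OF assms, of "transpose X" j i]
    by (metis (no_types, lifting) matrix_transpose_mul transpose_transpose transpose_def
        vec_lambda_beta right_proj_simps(1)[OF assms])
  show ?thesis
    by (auto simp: vec_eq_iff block_mat_def Let_def 1 2 I_left_mult_nth[OF assms] 
        right_proj_mult_nth[OF assms] transpose_def[of B])
qed

lemma transpose_block_mat:
  fixes A :: "('p::{finite,linorder},'p) rmat" and B :: "('n::{finite,linorder},'p) rmat"
  assumes "CARD('p) \<le> CARD('n)" "transpose A = - A"
  shows "transpose (block_mat A B) = - block_mat A B"
  by (simp add: block_mat_eq assms mat_expand right_proj_simps)

lemma Q_space_skew:
  assumes "CARD('p::{finite,linorder}) \<le> CARD('n::{finite,linorder})"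
    and "V \<in> (Q_space TYPE('p) :: (('n,'n) rmat) set)"
  shows "transpose V = - V"
  using assms transpose_block_mat[OF assms(1)] unfolding Q_space_def by auto

lemma subspace_Q_space:
  assumes le: "CARD('p::{finite,linorder}) \<le> CARD('n::{finite,linorder})"
  shows "subspace (Q_space TYPE('p) :: (('n,'n) rmat) set)"
proof (rule subspaceI)
  show "0 \<in> (Q_space TYPE('p) :: (('n,'n) rmat) set)"
    unfolding Q_space_def
    by (rule CollectI, rule exI[of _ 0], rule exI[of _ 0])
      (simp add: block_mat_def vec_eq_iff Let_def transpose_def)
next
  fix V W :: "('n,'n) rmat"
  assume "V \<in> Q_space TYPE('p)" "W \<in> Q_space TYPE('p)"
  then obtain A A' :: "('p,'p) rmat" and B B' :: "('n,'p) rmat"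
    where *: "V = block_mat A B" "W = block_mat A' B'" "transpose A = - A" "transpose A' = - A'"
    unfolding Q_space_def by blast
  have "V + W = block_mat (A + A') (B + B')"
    by (simp add: * block_mat_eq[OF le] mat_expand)
  moreover have "transpose (A + A') = - (A + A')"
    by (simp add: transpose_add *)
  ultimately show "V + W \<in> Q_space TYPE('p)"
    unfolding Q_space_def by blast
next
  fix c :: real and V :: "('n,'n) rmat"
  assume "V \<in> Q_space TYPE('p)"
  then obtain A :: "('p,'p) rmat" and B :: "('n,'p) rmat"
    where *: "V = block_mat A B" "transpose A = - A"
    unfolding Q_space_def by blast
  have "c *\<^sub>R V = block_mat (c *\<^sub>R A) (c *\<^sub>R B)"
    by (simp add: * block_mat_eq[OF le] mat_expand algebra_simps)
  moreover have "transpose (c *\<^sub>R A) = - (c *\<^sub>R A)"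
    by (simp add: transpose_scalar *)
  ultimately show "c *\<^sub>R V \<in> Q_space TYPE('p)"
    unfolding Q_space_def by blast
qed

text \<open>Splitting \<open>X + I_left\<close> into its upper block \<open>mat 1 + transpose I_left ** X\<close> and its lower block
  \<open>right_proj ** X\<close> and multiplying blockwise.\<close>

lemma block_mat_mult_shift:
  fixes A :: "('p::{finite,linorder},'p) rmat" and B X :: "('n::{finite,linorder},'p) rmat"
  assumes "CARD('p) \<le> CARD('n)"
  shows "block_mat A B ** (X + I_left)
    = I_left ** (A ** (mat 1 + transpose I_left ** X) - transpose B ** right_proj TYPE('p) ** X)
    + right_proj TYPE('p) ** B ** (mat 1 + transpose I_left ** X)"
  by (simp add: block_mat_eq assms mat_expand right_proj_simps I_left_orthonormal algebra_simps)

text \<open>This is the equation \<open>(mat 1 + V) ** X = (mat 1 - V) ** I_left\<close>, which determines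
  \<open>X = transpose S ** U\<close> from \<open>V = cayley S U\<close>, with the terms containing \<open>V\<close> collected
  on the left. With \<open>P\<close> the upper block of \<open>X\<close>, its lower blocks agree by the choice of \<open>cayley_B\<close>.
  Its upper blocks reduce to \<open>(P\<^sup>T - P) + (1 - P\<^sup>T P) = (1 + P)\<^sup>T (1 - P)\<close>, where
  \<open>1 - P\<^sup>T P\<close> is the Gram matrix of the lower block because the columns of \<open>X\<close> are
  orthonormal.\<close>

lemma cayley_mult_shift:
  fixes S :: "('n::{finite,linorder},'n) rmat" and U :: "('n,'p::{finite,linorder}) rmat"
  assumes le: "CARD('p) \<le> CARD('n)" and S: "S \<in> stiefel" and U: "U \<in> stiefel - E_set S"
  shows "cayley S U ** (transpose S ** U + I_left) = I_left - transpose S ** U"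
proof -
  define X where "X = transpose S ** U"
  define P where "P = transpose (I_left :: ('n,'p) rmat) ** X"
  define M where "M = matrix_inv (mat 1 + P)"
  let ?J = "I_left :: ('n,'p) rmat" and ?F = "right_proj TYPE('p) :: ('n,'n) rmat"
  have XX: "transpose X ** X = mat 1"
    using U by (simp add: X_def mat_expand matrix_mul_cancel stiefel_square[OF S])
      (simp add: stiefel_def)
  have le_P: "transpose (S_le S) ** U = P" "transpose U ** S_le S = transpose P"
    by (simp_all add: S_le_eq P_def X_def mat_expand)
  have ri_X: "transpose (S_ri TYPE('p) S) ** U = ?F ** X"
    by (simp add: S_ri_eq[OF le] X_def mat_expand right_proj_simps[OF le])
  have "invertible (mat 1 + P)"
    using U by (simp add: E_set_def le_P invertible_det_nz)
  then have M: "M ** (mat 1 + P) = mat 1" 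
    unfolding M_def by (rule matrix_inv_mult)
  have A: "cayley_A S U = transpose M ** (transpose P - P) ** M"
    by (simp add: cayley_A_def Let_def le_P M_def skew_def mat_expand)
  have B: "cayley_B S U = - (?F ** X ** M)"
    by (simp add: cayley_B_def ri_X le_P M_def)
  have FX: "transpose X ** (?F ** X) = mat 1 - transpose P ** P"
    by (simp add: right_proj_def P_def mat_expand XX)
  have "(transpose P - P) + (mat 1 - transpose P ** P) = transpose (mat 1 + P) ** (mat 1 - P)"
    by (simp add: mat_expand)
  then have *: "transpose M ** ((transpose P - P) + (mat 1 - transpose P ** P)) = mat 1 - P"
    by (metis M matrix_left_right_inverse matrix_mul_cancel matrix_transpose_mul transpose_mat)
  have 1: "cayley_A S U ** (mat 1 + P) = transpose M ** (transpose P - P)"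
    by (simp only: A matrix_mul_assoc[symmetric] M matrix_mul_rid)
  have 2: "transpose (cayley_B S U) ** ?F ** X = - (transpose M ** (mat 1 - transpose P ** P))"
    by (simp only: B mat_expand right_proj_simps[OF le] matrix_mul_assoc[of ?F ?F] FX)
  have 3: "?F ** cayley_B S U ** (mat 1 + P) = - (?F ** X)"
    by (simp only: B matrix_mul_assoc[symmetric] M matrix_mul_rid matrix_minus_left matrix_minus_right)
      (simp only: matrix_mul_assoc right_proj_simps[OF le])
  have "cayley S U ** (X + ?J) = ?J ** (mat 1 - P) - ?F ** X"
    unfolding cayley_def block_mat_mult_shift[OF le] P_def[symmetric] 1 2 3
    using arg_cong[OF *, of "(**) ?J"] by (simp add: mat_expand algebra_simps)
  then show ?thesis
    by (simp add: X_def[symmetric] right_proj_def P_def mat_expand)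
qed

lemma cayley_in_Q_space:
  "cayley S U \<in> Q_space TYPE('p)" for U :: "('n::{finite,linorder},'p::{finite,linorder}) rmat"
  unfolding cayley_def Q_space_def
  by (auto simp: cayley_A_def Let_def skew_def mat_expand algebra_simps intro!: exI)

text \<open>Adding \<open>X + I_left\<close> to both sides of the preceding equation gives
  \<open>(mat 1 + V) ** (X + I_left) = 2 *\<^sub>R I_left\<close>.\<close>

lemma resolvent_cayley_I_left:
  fixes S :: "('n::{finite,linorder},'n) rmat" and U :: "('n,'p::{finite,linorder}) rmat"
  assumes le: "CARD('p) \<le> CARD('n)" and S: "S \<in> stiefel" and U: "U \<in> stiefel - E_set S"
  shows "2 *\<^sub>R (matrix_inv (mat 1 + cayley S U) ** I_left) = transpose S ** U + I_left"
proof -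
  let ?V = "cayley S U" and ?X = "transpose S ** U"
  have skew: "transpose ?V = - ?V"
    using Q_space_skew[OF le cayley_in_Q_space] .
  have "(mat 1 + ?V) ** (?X + I_left) = 2 *\<^sub>R I_left"
    using cayley_mult_shift[OF assms] by (simp only: matrix_add_rdistrib matrix_mul_lid) (simp add: scaleR_2)
  then show ?thesis
    by (metis matrix_mul_cancel resolvent_skew(2)[OF skew] matrix_scaleR_right)
qed

lemma cayley_inv_cayley:
  fixes S :: "('n::{finite,linorder},'n) rmat" and U :: "('n,'p::{finite,linorder}) rmat"
  assumes le: "CARD('p) \<le> CARD('n)" and S: "S \<in> stiefel" and U: "U \<in> stiefel - E_set S"
  shows "cayley_inv S (cayley S U) = U"
  by (simp add: cayley_inv_skew[OF Q_space_skew[OF le cayley_in_Q_space]]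
      resolvent_cayley_I_left[OF assms] matrix_mul_cancel[OF stiefel_square[OF S]])

section \<open>Tangent spaces of the Stiefel manifold\<close>

text \<open>The tangent space of the Stiefel manifold at \<open>U\<close>, in the usual description as the kernel of the
  derivative of \<open>U \<mapsto> transpose U ** U\<close>.\<close>

definition stiefel_tangent :: "('n::finite,'p::finite) rmat \<Rightarrow> ('n,'p) rmat set" where
  "stiefel_tangent U = {Z. transpose (transpose U ** Z) = - (transpose U ** Z)}"

text \<open>If the two equations hold, then \<open>G = U ** \<Sigma>\<close> with a symmetric \<open>\<Sigma>\<close>, and symmetric
  matrices are orthogonal to skew ones. Conversely, the residual of each equation yields a tangent
  vector, and orthogonality to that vector says that the residual has norm 0.\<close>

lemma stationary_iff_orthogonal_tangent:
  fixes U G :: "('n::finite,'p::finite) rmat"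
  assumes "U \<in> stiefel"
  shows "((mat 1 - U ** transpose U) ** G = 0 \<and> transpose U ** G - transpose G ** U = 0)
    \<longleftrightarrow> (\<forall>Z\<in>stiefel_tangent U. inner G Z = 0)"
proof (intro iffI ballI)
  fix Z assume *: "(mat 1 - U ** transpose U) ** G = 0 \<and> transpose U ** G - transpose G ** U = 0"
    and Z: "Z \<in> stiefel_tangent U"
  have "G = U ** (transpose U ** G)"
    using conjunct1[OF *] by (simp add: mat_expand)
  then have "inner G Z = inner (transpose U ** G) (transpose U ** Z)"
    by (metis inner_matrix_mult_left)
  also have "\<dots> = 0"
    using * Z by (intro inner_symmetric_skew) (simp_all add: stiefel_tangent_def mat_expand)
  finally show "inner G Z = 0" .
next
  assume orth: "\<forall>Z\<in>stiefel_tangent U. inner G Z = 0"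
  have UU: "transpose U ** U = mat 1"
    using assms by (simp add: stiefel_def)
  define N where "N = (mat 1 - U ** transpose U) ** G"
  define \<Omega> where "\<Omega> = transpose U ** G - transpose G ** U"
  have UN: "transpose U ** N = 0"
    by (simp add: N_def mat_expand matrix_mul_cancel[OF UU])
  have "G = N + U ** (transpose U ** G)"
    by (simp add: N_def mat_expand)
  then have "inner G N = inner N N"
    by (metis UN add.right_neutral inner_add_left inner_matrix_mult_left inner_zero_right)
  moreover have "N \<in> stiefel_tangent U"
    using UN by (simp add: stiefel_tangent_def transpose_def zero_vec_def)
  ultimately have "N = 0"
    using orth by auto
  have skew: "transpose \<Omega> = - \<Omega>"
    by (simp add: \<Omega>_def mat_expand)
  then have "U ** \<Omega> \<in> stiefel_tangent U"
    by (simp add: stiefel_tangent_def matrix_mul_cancel[OF UU])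
  with orth have "inner G (U ** \<Omega>) = 0" by blast
  moreover have "inner (transpose U ** G) \<Omega> = inner G (U ** \<Omega>)"
    by (simp add: inner_matrix_mult_left)
  ultimately have "inner (transpose U ** G) \<Omega> = 0" by simp
  moreover have "inner (transpose G ** U) \<Omega> = - inner (transpose U ** G) \<Omega>"
    using inner_transpose[of "transpose U ** G" \<Omega>] by (simp add: skew mat_expand)
  ultimately have "inner \<Omega> \<Omega> = 0"
    by (subst (1) \<Omega>_def) (simp add: inner_diff_left)
  with \<open>N = 0\<close> show "(mat 1 - U ** transpose U) ** G = 0 \<and> transpose U ** G - transpose G ** U = 0"
    unfolding N_def \<Omega>_def by simp
qed

text \<open>Solving \<open>D ** (X + I_left) = W\<close> blockwise: as \<open>mat 1 + transpose I_left ** X\<close> is invertible,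
  the lower blocks determine \<open>B\<close> and then the upper blocks determine \<open>A\<close>. The condition on \<open>W\<close>, which
  is necessary since \<open>D\<close> is skew, makes this \<open>A\<close> skew.\<close>

lemma Q_space_mult_shift_surj:
  fixes X W :: "('n::{finite,linorder},'p::{finite,linorder}) rmat"
  assumes le: "CARD('p) \<le> CARD('n)"
    and inv: "invertible (mat 1 + transpose I_left ** X)"
    and skew: "transpose (transpose (X + I_left) ** W) = - (transpose (X + I_left) ** W)"
  obtains D where "D \<in> Q_space TYPE('p)" "D ** (X + I_left) = W"
proof -
  let ?J = "I_left :: ('n,'p) rmat" and ?F = "right_proj TYPE('p) :: ('n,'n) rmat"
  define N where "N = mat 1 + transpose ?J ** X"
  define M where "M = matrix_inv N"
  have MN: "M ** N = mat 1" "N ** M = mat 1"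
    using inv unfolding M_def N_def by (auto dest: matrix_inv_mult)
  define A where "A = (transpose ?J ** W + transpose (W ** M) ** ?F ** X) ** M"
  have split: "X + ?J = ?J ** N + ?F ** X"
    by (simp add: N_def right_proj_def mat_expand)
  have MTN: "transpose M ** (transpose N ** Y) = Y" for Y :: "('p,'p) rmat"
    by (rule matrix_mul_cancel) (metis MN(2) matrix_transpose_mul transpose_mat)
  define T where "T = transpose (X + ?J) ** W"
  have T: "T = transpose N ** (transpose ?J ** W) + transpose X ** (?F ** W)"
    unfolding T_def split by (simp add: mat_expand right_proj_simps[OF le])
  have "A = transpose M ** (transpose N ** (transpose ?J ** W) + transpose W ** (?F ** X)) ** M"
    by (simp add: A_def mat_expand MTN)
  then have A: "A = transpose M ** (T + transpose W ** (?F ** X) - transpose X ** (?F ** W)) ** M"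
    by (simp add: T)
  \<comment> \<open>\<open>A\<close> is congruent to \<open>T\<close>, which is skew by assumption, plus a matrix minus its transpose.\<close>
  have "transpose A = - A"
    using skew unfolding A T_def[symmetric]
    by (simp add: mat_expand right_proj_simps[OF le])
  then have "block_mat A (W ** M) \<in> Q_space TYPE('p)"
    unfolding Q_space_def by blast
  moreover have "block_mat A (W ** M) ** (X + ?J) = W"
  proof -
    have 1: "A ** N = transpose ?J ** W + transpose (W ** M) ** ?F ** X"
      by (simp only: A_def matrix_mul_assoc[symmetric] MN matrix_mul_rid)
    have 2: "?F ** (W ** M) ** N = ?F ** W"
      by (simp only: matrix_mul_assoc[symmetric] MN matrix_mul_rid)
    show ?thesis
      unfolding block_mat_mult_shift[OF le] N_def[symmetric] 1 2
      by (simp add: right_proj_def mat_expand)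
  qed
  ultimately show thesis by (rule that)
qed

text \<open>The differential of the inverse Cayley transform is onto the tangent space; it is this fact that
  lets stationarity be tested in the chart. The computation rests on
  \<open>2 *\<^sub>R (K ** I_left) = X + I_left\<close> and on \<open>transpose X ** K = transpose (K ** I_left)\<close>, where
  \<open>X = transpose S ** U\<close>. The second turns \<open>transpose U\<close> times the image of \<open>D\<close> into a congruence
  transform of \<open>D\<close>, so images are tangent. By the first, reaching a tangent vector \<open>Z\<close> means
  solving \<open>D ** (X + I_left) = W\<close> for \<open>W = - ((mat 1 + V) ** (transpose S ** Z))\<close>.\<close>

lemma cayley_inv_derivative_range:
  fixes S :: "('n::{finite,linorder},'n) rmat" and U :: "('n,'p::{finite,linorder}) rmat"
  assumes le: "CARD('p) \<le> CARD('n)" and S: "S \<in> stiefel" and U: "U \<in> stiefel - E_set S"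
  defines "K \<equiv> matrix_inv (mat 1 + cayley S U)"
  shows "(\<lambda>D. (-2) *\<^sub>R (S ** K ** D ** K ** I_left)) ` Q_space TYPE('p) = stiefel_tangent U"
proof -
  let ?J = "I_left :: ('n,'p) rmat"
  define V where "V = cayley S U"
  define X where "X = transpose S ** U"
  have V: "transpose V = - V"
    unfolding V_def using Q_space_skew[OF le cayley_in_Q_space] .
  have K: "K ** (mat 1 + V) = mat 1" "(mat 1 + V) ** K = mat 1"
    using resolvent_skew[OF V] by (simp_all add: K_def V_def)
  have KJ: "2 *\<^sub>R (K ** ?J) = X + ?J"
    using resolvent_cayley_I_left[OF le S U] by (simp add: K_def X_def)
  have SX: "S ** X = U"
    by (simp add: X_def matrix_mul_cancel[OF stiefel_square[OF S]])
  have KT: "transpose K ** (mat 1 - V) = mat 1"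
    using arg_cong[OF K(2), of transpose] by (simp add: mat_expand V)
  \<comment> \<open>\<open>2 = (mat 1 - V) + (mat 1 + V)\<close>, placed between \<open>transpose K\<close> and \<open>K\<close>, cancels one of them
    in each summand.\<close>
  have "K + transpose K = (transpose K ** (mat 1 - V)) ** K + transpose K ** ((mat 1 + V) ** K)"
    unfolding KT K by simp
  also have "\<dots> = 2 *\<^sub>R (transpose K ** K)"
    by (simp add: mat_expand scaleR_2)
  finally have KK: "2 *\<^sub>R (transpose K ** K) = K + transpose K" by simp
  have XK: "transpose X ** K = transpose ?J ** transpose K"
  proof -
    have "X = 2 *\<^sub>R (K ** ?J) - ?J" using KJ by simp
    then have "transpose X ** K = transpose ?J ** (2 *\<^sub>R (transpose K ** K)) - transpose ?J ** K"
      by (simp add: mat_expand)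
    then show ?thesis unfolding KK by (simp add: mat_expand)
  qed
  show ?thesis
  proof (intro equalityI subsetI)
    fix Z :: "('n,'p) rmat"
    assume "Z \<in> (\<lambda>D. (-2) *\<^sub>R (S ** K ** D ** K ** I_left)) ` Q_space TYPE('p)"
    then obtain D where D: "D \<in> Q_space TYPE('p)" and Z: "Z = (-2) *\<^sub>R (S ** K ** D ** K ** I_left)"
      by blast
    have "transpose U ** (S ** Y) = transpose X ** Y" for Y :: "('n,'p) rmat"
      by (simp add: X_def mat_expand)
    then have "transpose U ** Z = (-2) *\<^sub>R (transpose X ** K ** (D ** (K ** ?J)))"
      by (simp add: Z mat_expand)
    then have UZ: "transpose U ** Z = (-2) *\<^sub>R (transpose ?J ** (transpose K ** (D ** (K ** ?J))))"
      unfolding XK by (simp add: mat_expand)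
    show "Z \<in> stiefel_tangent U"
      unfolding stiefel_tangent_def mem_Collect_eq UZ
      by (simp add: mat_expand Q_space_skew[OF le D])
  next
    fix Z assume Z: "Z \<in> stiefel_tangent U"
    define W where "W = - ((mat 1 + V) ** (transpose S ** Z))"
    have "transpose (X + ?J) ** W = - (2 *\<^sub>R (transpose X ** K ** ((mat 1 + V) ** (transpose S ** Z))))"
      unfolding KJ[symmetric] XK W_def by (simp add: mat_expand scaleR_add_right)
    also have "\<dots> = - (2 *\<^sub>R (transpose X ** (transpose S ** Z)))"
      by (simp only: matrix_mul_assoc[symmetric] matrix_mul_cancel[OF K(1)])
    also have "transpose X ** (transpose S ** Z) = transpose U ** Z"
      unfolding SX[symmetric] by (simp add: mat_expand)
    finally have XW: "transpose (X + ?J) ** W = - (2 *\<^sub>R (transpose U ** Z))" .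
    have skew: "transpose (transpose (X + ?J) ** W) = - (transpose (X + ?J) ** W)"
      using Z unfolding XW transpose_minus transpose_scalar by (simp add: stiefel_tangent_def)
    have inv: "invertible (mat 1 + transpose ?J ** X)"
      using U by (simp add: E_set_def invertible_det_nz S_le_eq X_def mat_expand)
    obtain D where D: "D \<in> Q_space TYPE('p)" "D ** (X + ?J) = W"
      using Q_space_mult_shift_surj[OF le inv skew] .
    have "(-2) *\<^sub>R (S ** K ** D ** K ** ?J) = - (S ** (K ** (D ** (2 *\<^sub>R (K ** ?J)))))"
      by (simp add: mat_expand)
    also have "\<dots> = S ** (K ** ((mat 1 + V) ** (transpose S ** Z)))"
      by (simp only: KJ D W_def matrix_minus_right minus_minus)
    also have "\<dots> = Z"
      by (simp only: matrix_mul_cancel[OF K(1)] matrix_mul_cancel[OF stiefel_square[OF S]])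
    finally have "Z = (-2) *\<^sub>R (S ** K ** D ** K ** ?J)" by (rule sym)
    then show "Z \<in> (\<lambda>D. (-2) *\<^sub>R (S ** K ** D ** K ** I_left)) ` Q_space TYPE('p)"
      using D(1) by (rule image_eqI)
  qed
qed

section \<open>Gradients\<close>

text \<open>Existence of the representing matrix is the Riesz theorem, here through the adjoint of the
  derivative; its uniqueness makes the definite description denote.\<close>

lemma has_derivative_gradient:
  fixes f :: "('n::finite,'m::finite) rmat \<Rightarrow> real"
  assumes "f differentiable (at X)"
  shows "(f has_derivative (\<lambda>D. inner (gradient f X) D)) (at X)"
proof -
  obtain f' where f': "(f has_derivative f') (at X)"
    using assms by (auto simp: differentiable_def)
  define G where "G = adjoint f' 1"
  have "f' = (\<lambda>D. inner G D)"
    using adjoint_works[OF has_derivative_linear[OF f'], of _ 1]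
    by (auto simp: G_def inner_commute)
  with f' have G: "(f has_derivative (\<lambda>D. frob_inner G D)) (at X)"
    by (simp add: frob_inner_eq_inner)
  have "gradient f X = G"
    unfolding gradient_def
  proof (rule the_equality)
    show "(f has_derivative (\<lambda>D. frob_inner G D)) (at X)" by (rule G)
  next
    fix G' assume "(f has_derivative (\<lambda>D. frob_inner G' D)) (at X)"
    then have "(\<lambda>D. inner G' D) = (\<lambda>D. inner G D)"
      using G unfolding frob_inner_eq_inner by (rule has_derivative_unique)
    then show "G' = G" by (metis inner_commute vector_eq_rdot)
  qed
  with G show ?thesis by (simp add: frob_inner_eq_inner)
qed

text \<open>The gradient relative to a subspace is the orthogonal projection onto it of a matrix that represents
  the directional derivatives, so it vanishes exactly when they vanish along the subspace.\<close>

lemma gradient_on_eq_0_iff: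
  fixes g :: "('n::finite,'m::finite) rmat \<Rightarrow> real"
  assumes Q: "subspace Q" and "linear l"
    and l: "\<And>D. D \<in> Q \<Longrightarrow> ((\<lambda>t. g (V + t *\<^sub>R D)) has_real_derivative l D) (at 0)"
  shows "gradient_on Q g V = 0 \<longleftrightarrow> (\<forall>D\<in>Q. l D = 0)"
proof -
  obtain G z where "G \<in> span Q" and z: "\<And>w. w \<in> span Q \<Longrightarrow> orthogonal z w"
    and "adjoint l 1 = G + z"
    using orthogonal_subspace_decomp_exists[of Q "adjoint l 1"] by metis
  then have G: "G \<in> Q" using Q by (metis span_eq_iff)
  have lG: "l D = inner G D" if "D \<in> Q" for D
    using adjoint_works[OF \<open>linear l\<close>, of D 1] z[OF span_base[OF that]]
    by (simp add: \<open>adjoint l 1 = G + z\<close> inner_add_right orthogonal_def inner_commute)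
  have "gradient_on Q g V = G"
    unfolding gradient_on_def frob_inner_eq_inner
  proof (rule the_equality)
    show "G \<in> Q \<and> (\<forall>D\<in>Q. ((\<lambda>t. g (V + t *\<^sub>R D)) has_real_derivative inner G D) (at 0))"
      using G l lG by auto
  next
    fix G' assume G': "G' \<in> Q \<and> (\<forall>D\<in>Q. ((\<lambda>t. g (V + t *\<^sub>R D)) has_real_derivative inner G' D) (at 0))"
    then have "G' - G \<in> Q" using G Q by (simp add: subspace_diff)
    then have "inner G' (G' - G) = inner G (G' - G)"
      using G' l lG by (metis DERIV_unique)
    then have "inner (G' - G) (G' - G) = 0" by (simp add: inner_diff_left)
    then show "G' = G" by simp
  qed
  with lG G show ?thesis by (metis inner_eq_zero_iff inner_zero_left)
qed

theorem lemma3p4: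
  fixes f :: "('n::{finite,linorder},'p::{finite,linorder}) rmat \<Rightarrow> real"
    and U :: "('n,'p) rmat"
    and S :: "('n,'n) rmat"
  assumes "CARD('p) \<le> CARD('n)"
    and "\<And>X. f differentiable (at X)"
    and "S \<in> stiefel"
    and "U \<in> stiefel - E_set S"
  shows "((mat 1 - U ** transpose U) ** gradient f U = 0 \<and>
          transpose U ** gradient f U - transpose (gradient f U) ** U = 0)
     \<longleftrightarrow> gradient_on (Q_space TYPE('p)) (f \<circ> cayley_inv S) (cayley S U) = 0"
proof -
  define K where "K = matrix_inv (mat 1 + cayley S U)"
  define \<Delta> where "\<Delta> D = (-2) *\<^sub>R (S ** K ** D ** K ** (I_left :: ('n,'p) rmat))" for D
  define l where "l D = inner (gradient f U) (\<Delta> D)" for D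
  have "((\<lambda>t. (f \<circ> cayley_inv S) (cayley S U + t *\<^sub>R D)) has_real_derivative l D) (at 0)"
    if D: "D \<in> Q_space TYPE('p)" for D
  proof -
    have "((\<lambda>t. cayley_inv S (cayley S U + t *\<^sub>R D) :: ('n,'p) rmat)
        has_derivative (\<lambda>t. t *\<^sub>R \<Delta> D)) (at 0)"
      using cayley_inv_has_vector_derivative[OF Q_space_skew[OF assms(1) cayley_in_Q_space]
          Q_space_skew[OF assms(1) D]]
      unfolding has_vector_derivative_def \<Delta>_def K_def .
    moreover have "(f has_derivative (\<lambda>D. inner (gradient f U) D))
        (at (cayley_inv S (cayley S U + 0 *\<^sub>R D)))"
      using has_derivative_gradient[OF assms(2)] cayley_inv_cayley[OF assms(1,3,4)] by simp
    ultimately have "((\<lambda>t. f (cayley_inv S (cayley S U + t *\<^sub>R D)))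
        has_derivative (\<lambda>t. inner (gradient f U) (t *\<^sub>R \<Delta> D))) (at 0)"
      using diff_chain_at by (force simp: o_def)
    then show ?thesis
      by (simp add: has_field_derivative_def l_def o_def mult_commute_abs)
  qed
  moreover have "linear l"
    by (rule linearI) (simp_all add: l_def \<Delta>_def mat_expand inner_add_right algebra_simps)
  ultimately have "gradient_on (Q_space TYPE('p)) (f \<circ> cayley_inv S) (cayley S U) = 0
      \<longleftrightarrow> (\<forall>D\<in>Q_space TYPE('p). l D = 0)"
    using gradient_on_eq_0_iff[OF subspace_Q_space[OF assms(1)]] by blast
  also have "\<dots> \<longleftrightarrow> (\<forall>Z\<in>\<Delta> ` Q_space TYPE('p). inner (gradient f U) Z = 0)"
    by (simp add: l_def)
  also have "\<Delta> ` Q_space TYPE('p) = stiefel_tangent U"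
    using cayley_inv_derivative_range[OF assms(1,3,4)] by (simp add: \<Delta>_def[abs_def] K_def)
  also have "(\<forall>Z\<in>stiefel_tangent U. inner (gradient f U) Z = 0) \<longleftrightarrow>
      ((mat 1 - U ** transpose U) ** gradient f U = 0 \<and>
          transpose U ** gradient f U - transpose (gradient f U) ** U = 0)"
    using stationary_iff_orthogonal_tangent assms(4) by (metis DiffD1)
  finally show ?thesis by blast
qed

end
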